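(* Let $F\subset[0,1]$ be a fat Cantor set, that is, a compact nowhere dense set with $\mathcal L^1(F)>0$, and set $A:=F\times F\subset\mathbb{R}^2$. Let \[ \mathcal D_F=\left\{p\in F:\lim_{r\downarrow0}\frac{\mathcal L^1(F\cap(p-r,p+r))}{2r}=1\right\},\qquad \mathcal D_A:=\mathcal D_F\times\mathcal D_F. \] Then for every $z=(p,q)\in\mathcal D_A$ one has \[ \dim_{\mathrm{Pbox}}\{z\}_A=2\quad\text{and}\quad\dim_{\times}\{z\}_A=2. \] Consequently, on the relative full-measure set $\mathcal D_A\subset A$ (i.e. $\mathcal L^2(A\setminus\mathcal D_A)=0$), $\dim_{\mathrm{Pbox}}\{z\}_A=\dim_{\times}\{z\}_A$.
   Context: $\mathcal L^d$ is $d$-dimensional Lebesgue measure. Tangent cone: for $A\subset\mathbb{R}^n$, $\mathrm{Tan}_x(A)$ is the set of $v\in\mathbb{R}^n$ for which there exist $x_k\in A$, $x_k\to x$, and positive reals $\lambda_k\downarrow0$ with $(x_k-x)/\lambda_k\to v$. Effective directions: $\mathrm{Eff}_x(A):=\mathrm{Tan}_x(A)\cap S^{n-1}$ if $x\in\overline A$ (and $\varnothing$ otherwise). For $v\ne0$ let $[v]=\mathbb{R}v\in\mathbb{P}^{n-1}$; $\mathrm{Eff}_x^{\mathbb P}(A):=\{[v]:v\in\mathrm{Eff}_x(A)\}$. Admissible probes: for $x\in\overline A$, $v\in S^{n-1}$, $\mathcal G_x^A(v)$ is the family of all injective Lipschitz maps $\gamma:[0,\delta]\to\mathbb{R}^n$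 (some $\delta>0$) with $\gamma(0)=x$, $\lim_{t\to0^+}\frac{\gamma(t)-x}{\|\gamma(t)-x\|}=v$, and $A\cap\gamma((0,\eta])\ne\varnothing$ for every $\eta\in(0,\delta]$; $\Gamma_\gamma:=\gamma([0,\delta])$. Point-extended box dimension: for bounded $E$, $N_\varepsilon(E)$ is the minimal number of sets of diameter at most $\varepsilon$ covering $E$ and $\overline{\dim}_B(E):=\limsup_{\varepsilon\to0}\frac{\ln N_\varepsilon(E)}{\ln(1/\varepsilon)}$. For $x\in\overline E$, $\dim_{\mathrm{Pbox}}\{x\}_E:=\inf_{r>0}\overline{\dim}_B(E\cap B(x,r))$; it is $0$ if $x\notin\overline E$. Directional contribution: for $v\in\mathrm{Eff}_x(A)$, $\theta_x^A(v):=\sup_{\gamma\in\mathcal G_x^A(v)}\dim_{\mathrm{Pbox}}\{x\}_{A\cap\Gamma_\gamma}$; for $\xi\in\mathrm{Eff}_x^{\mathbb P}(A)$, $\theta_x^A(\xi):=\sup\{\theta_x^A(w):w\in\mathrm{Eff}_x(A),[w]=\xi\}$. Point-Cross dimension at $x\in\overline A$: $\dim_\times\{x\}_A:=\sup\sum_{i=1}^m\theta_x^A(\xi_i)$ over all $m\in\{0,\dots,n\}$ and all $\xi_1,\dots,\xi_m\in\mathrm{Eff}_x^{\mathbb P}(A)$ that are projectively (linearly) independent, i.e. nonzero representatives are linearly independent (empty family allowed, with sum $0$). *)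

theory Defs
  imports "HOL-Analysis.Analysis"
begin

text \<open>
  The ambient space \<open>\<real>\<^sup>n\<close> is a type of class \<open>euclidean_space\<close> with \<open>n = DIM('a)\<close>.
  All dimensions are values in \<open>[0, \<infinity>]\<close>, i.e. of type \<^typ>\<open>ennreal\<close>;
  in particular a supremum over an empty family is \<open>0\<close>.
\<close>

definition tangent_cone :: "'a::euclidean_space \<Rightarrow> 'a set \<Rightarrow> 'a set" where
  "tangent_cone x A = {v. \<exists>(X :: nat \<Rightarrow> 'a) (l :: nat \<Rightarrow> real).
     (\<forall>k. X k \<in> A) \<and> X \<longlonglongrightarrow> x \<and>
     (\<forall>k. l k > 0) \<and> decseq l \<and> l \<longlonglongrightarrow> 0 \<and>
     (\<lambda>k. (X k - x) /\<^sub>R l k) \<longlonglongrightarrow> v}"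

definition eff_dirs :: "'a::euclidean_space \<Rightarrow> 'a set \<Rightarrow> 'a set" where
  "eff_dirs x A = (if x \<in> closure A then tangent_cone x A \<inter> sphere 0 1 else {})"

text \<open>For \<open>v \<noteq> 0\<close>, the point \<open>[v]\<close> of projective space is the line \<open>span {v}\<close>.\<close>

definition proj_eff_dirs :: "'a::euclidean_space \<Rightarrow> 'a set \<Rightarrow> 'a set set" where
  "proj_eff_dirs x A = (\<lambda>v. span {v}) ` eff_dirs x A"

text \<open>
  A probe \<open>\<gamma> : [0, \<delta>] \<rightarrow> \<real>\<^sup>n\<close> is represented by the pair \<open>(\<delta>, \<gamma>)\<close>; the values of \<open>\<gamma>\<close> outside
  \<open>{0..\<delta>}\<close> are irrelevant.
\<close>

definition probes :: "'a::euclidean_space set \<Rightarrow> 'a \<Rightarrow> 'a \<Rightarrow> (real \<times> (real \<Rightarrow> 'a)) set" where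
  "probes A x v = {(\<delta>, \<gamma>). \<delta> > 0 \<and> inj_on \<gamma> {0..\<delta>} \<and> (\<exists>L. L-lipschitz_on {0..\<delta>} \<gamma>) \<and>
     \<gamma> 0 = x \<and>
     ((\<lambda>t. (\<gamma> t - x) /\<^sub>R norm (\<gamma> t - x)) \<longlongrightarrow> v) (at_right 0) \<and>
     (\<forall>\<eta>\<in>{0<..\<delta>}. A \<inter> \<gamma> ` {0<..\<eta>} \<noteq> {})}"

text \<open>
  Boundedness of the covering sets is required explicitly because \<^const>\<open>diameter\<close> is
  meaningless on unbounded sets. For bounded \<open>E\<close> and \<open>\<epsilon> > 0\<close> a finite cover exists.
\<close>

definition covering_number :: "real \<Rightarrow> 'a::euclidean_space set \<Rightarrow> nat" where
  "covering_number \<epsilon> E = (LEAST k. \<exists>U :: 'a set set. finite U \<and> card U = k \<and>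
     (\<forall>S\<in>U. bounded S \<and> diameter S \<le> \<epsilon>) \<and> E \<subseteq> \<Union>U)"

text \<open>
  For nonempty \<open>E\<close> and \<open>0 < \<epsilon> < 1\<close> the quotient is nonnegative, so \<^const>\<open>ennreal\<close> does not
  truncate anything relevant to the upper limit.
\<close>

definition upper_box_dim :: "'a::euclidean_space set \<Rightarrow> ennreal" where
  "upper_box_dim E =
     Limsup (at_right 0) (\<lambda>\<epsilon>. ennreal (ln (real (covering_number \<epsilon> E)) / ln (1 / \<epsilon>)))"

definition pbox_dim :: "'a::euclidean_space \<Rightarrow> 'a set \<Rightarrow> ennreal" where
  "pbox_dim x E =
     (if x \<in> closure E then (INF r\<in>{0<..}. upper_box_dim (E \<inter> ball x r)) else 0)"

definition dir_contrib :: "'a::euclidean_space \<Rightarrow> 'a set \<Rightarrow> 'a \<Rightarrow> ennreal" where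
  "dir_contrib x A v = (SUP (\<delta>, \<gamma>)\<in>probes A x v. pbox_dim x (A \<inter> \<gamma> ` {0..\<delta>}))"

definition proj_dir_contrib :: "'a::euclidean_space \<Rightarrow> 'a set \<Rightarrow> 'a set \<Rightarrow> ennreal" where
  "proj_dir_contrib x A \<xi> = (SUP w\<in>{w \<in> eff_dirs x A. span {w} = \<xi>}. dir_contrib x A w)"

text \<open>
  Injectivity of \<open>w\<close> is needed so that the vectors \<open>w 1, \<dots>, w m\<close> are independent as a family,
  not merely as a set.
\<close>

definition proj_independent :: "nat \<Rightarrow> (nat \<Rightarrow> 'a::euclidean_space set) \<Rightarrow> bool" where
  "proj_independent m \<xi> \<longleftrightarrow> (\<exists>w. (\<forall>i\<in>{1..m}. w i \<noteq> 0 \<and> span {w i} = \<xi> i) \<and>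
     inj_on w {1..m} \<and> independent (w ` {1..m}))"

definition cross_dim :: "'a::euclidean_space \<Rightarrow> 'a set \<Rightarrow> ennreal" where
  "cross_dim x A =
     (SUP (m, \<xi>)\<in>{(m, \<xi>). m \<le> DIM('a) \<and> (\<forall>i\<in>{1..m}. \<xi> i \<in> proj_eff_dirs x A) \<and>
                          proj_independent m \<xi>}.
        \<Sum>i=1..m. proj_dir_contrib x A (\<xi> i))"

definition fat_cantor :: "real set \<Rightarrow> bool" where
  "fat_cantor F \<longleftrightarrow> compact F \<and> interior (closure F) = {} \<and> measure lebesgue F > 0"

definition density_points :: "real set \<Rightarrow> real set" where
  "density_points F =
     {p \<in> F. ((\<lambda>r. measure lebesgue (F \<inter> {p - r<..<p + r}) / (2 * r)) \<longlongrightarrow> 1) (at_right 0)}"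

end

theory Submission
  imports Defs "HOL-Real_Asymp.Real_Asymp"
begin

text \<open>
  A set of positive measure in \<open>\<real>\<^sup>n\<close> has upper box dimension at least \<open>n\<close>, since sets of diameter
  at most \<open>\<epsilon>\<close> lie in balls of volume \<open>O(\<epsilon>\<^sup>n)\<close>. A density point \<open>p\<close> of \<open>F\<close> sees positive measure in
  every \<open>F \<inter> (p, p + \<eta>)\<close>. Hence all pieces of \<open>F \<times> F\<close> near a density point have dimension \<open>2\<close>,
  and the two axis-parallel segments are probes with directional contribution at least \<open>1\<close>.
  Conversely, every probe is a Lipschitz curve, so it contributes at most \<open>1\<close>, and at most
  \<open>n\<close> directions are summed. That almost every point of \<open>F\<close> is a density point is Lebesgue's density
  theorem, obtained here from Vitali's covering theorem.
\<close>

section \<open>Covering numbers and box dimension\<close>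

text \<open>Trades diameters for pairwise distances, the form in which covers are handled below.
  \<open>0 \<le> \<epsilon>\<close> takes care of the empty set, whose diameter is 0.\<close>

lemma bounded_diameter_le_iff:
  fixes S :: "'a::real_normed_vector set"
  assumes "0 \<le> \<epsilon>"
  shows "bounded S \<and> diameter S \<le> \<epsilon> \<longleftrightarrow> (\<forall>x\<in>S. \<forall>y\<in>S. dist x y \<le> \<epsilon>)"
proof safe
  show "dist x y \<le> \<epsilon>" if "bounded S" "diameter S \<le> \<epsilon>" "x \<in> S" "y \<in> S" for x y
    using diameter_bounded_bound[OF that(1,3,4)] that(2) by linarith
  show "bounded S" if "\<forall>x\<in>S. \<forall>y\<in>S. dist x y \<le> \<epsilon>"
    using that bounded_two_points by blast
  show "diameter S \<le> \<epsilon>" if "\<forall>x\<in>S. \<forall>y\<in>S. dist x y \<le> \<epsilon>"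
    using that assms by (auto intro!: diameter_le simp: dist_norm)
qed

lemma covering_number_le:
  fixes E :: "'a::euclidean_space set"
  assumes "0 < \<epsilon>" "finite U" "\<And>S x y. S \<in> U \<Longrightarrow> x \<in> S \<Longrightarrow> y \<in> S \<Longrightarrow> dist x y \<le> \<epsilon>" "E \<subseteq> \<Union>U"
  shows "covering_number \<epsilon> E \<le> card U"
  unfolding covering_number_def
proof (rule Least_le, intro exI conjI ballI)
  fix S assume "S \<in> U"
  then show "bounded S" "diameter S \<le> \<epsilon>"
    using bounded_diameter_le_iff[of \<epsilon> S] assms by (metis less_imp_le)+
qed (use assms in auto)

text \<open>The \<open>LEAST\<close> is attained because some finite cover exists: the closure of a
  bounded set is compact, hence totally bounded, and balls of radius \<open>\<epsilon>/2\<close>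
  have diameter at most \<open>\<epsilon>\<close>.\<close>

lemma covering_number_attained:
  fixes E :: "'a::euclidean_space set"
  assumes "bounded E" "0 < \<epsilon>"
  obtains U where "finite U" "card U = covering_number \<epsilon> E" "E \<subseteq> \<Union>U"
    "\<And>S x y. S \<in> U \<Longrightarrow> x \<in> S \<Longrightarrow> y \<in> S \<Longrightarrow> dist x y \<le> \<epsilon>"
proof -
  let ?P = "\<lambda>k. \<exists>U :: 'a set set. finite U \<and> card U = k \<and>
     (\<forall>S\<in>U. bounded S \<and> diameter S \<le> \<epsilon>) \<and> E \<subseteq> \<Union>U"
  have "compact (closure E)" using assms by (simp add: compact_closure)
  then obtain C where C: "finite C" "closure E \<subseteq> (\<Union>x\<in>C. ball x (\<epsilon>/2))"
    using compact_eq_totally_bounded \<open>0 < \<epsilon>\<close> by (metis half_gt_zero)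
  let ?U = "(\<lambda>x. ball x (\<epsilon>/2)) ` C"
  have "\<forall>S\<in>?U. bounded S \<and> diameter S \<le> \<epsilon>"
    using assms by auto
  then have "?P (card ?U)"
    using C closure_subset[of E] by (intro exI[of _ ?U]) auto
  then have "?P (covering_number \<epsilon> E)"
    unfolding covering_number_def by (rule LeastI)
  then obtain U where "finite U" "card U = covering_number \<epsilon> E" "E \<subseteq> \<Union>U"
    "\<forall>S\<in>U. bounded S \<and> diameter S \<le> \<epsilon>" by blast
  with that show thesis
    using bounded_diameter_le_iff[of \<epsilon>] assms by (metis less_imp_le)
qed

text \<open>A cover of \<open>E\<close> is pushed forward by \<open>f\<close>, each piece first cut
  down to \<open>E\<close>, where the Lipschitz bound holds. Since \<open>D\<close> need only lie
  inside the image, \<open>f = id\<close> yields monotonicity in the set.\<close>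

lemma covering_number_lipschitz_image:
  fixes f :: "'a::euclidean_space \<Rightarrow> 'b::euclidean_space"
  assumes "L-lipschitz_on E f" "0 < L" "D \<subseteq> f ` E" "0 < \<epsilon>" "bounded E"
  shows "covering_number (L * \<epsilon>) D \<le> covering_number \<epsilon> E"
proof -
  obtain U where U: "finite U" "card U = covering_number \<epsilon> E" "E \<subseteq> \<Union>U"
    "\<And>S x y. S \<in> U \<Longrightarrow> x \<in> S \<Longrightarrow> y \<in> S \<Longrightarrow> dist x y \<le> \<epsilon>"
    using covering_number_attained assms by metis
  have "covering_number (L * \<epsilon>) D \<le> card ((\<lambda>S. f ` (E \<inter> S)) ` U)"
  proof (rule covering_number_le)
    fix T x y assume "T \<in> (\<lambda>S. f ` (E \<inter> S)) ` U" "x \<in> T" "y \<in> T"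
    then obtain S a b where S: "S \<in> U" "a \<in> E" "b \<in> E" "a \<in> S" "b \<in> S" "x = f a" "y = f b"
      by auto
    then have "dist x y \<le> L * dist a b"
      using assms(1) by (auto dest: lipschitz_onD)
    also have "\<dots> \<le> L * \<epsilon>"
      using U(4)[OF S(1,4,5)] \<open>0 < L\<close> by (intro mult_left_mono) auto
    finally show "dist x y \<le> L * \<epsilon>" .
  next
    show "D \<subseteq> \<Union> ((\<lambda>S. f ` (E \<inter> S)) ` U)"
    proof
      fix y assume "y \<in> D"
      then obtain x where "x \<in> E" "y = f x" using assms(3) by auto
      moreover from this obtain S where "S \<in> U" "x \<in> S" using U(3) by auto
      ultimately show "y \<in> \<Union> ((\<lambda>S. f ` (E \<inter> S)) ` U)" by auto
    qed
  qed (use U assms in auto)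
  then show ?thesis
    using card_image_le[OF U(1), of "\<lambda>S. f ` (E \<inter> S)"] U(2) by linarith
qed

lemma covering_number_Times:
  fixes D :: "'a::euclidean_space set" and E :: "'b::euclidean_space set"
  assumes "bounded D" "bounded E" "0 < \<epsilon>"
  shows "covering_number (2 * \<epsilon>) (D \<times> E) \<le> covering_number \<epsilon> D * covering_number \<epsilon> E"
proof -
  obtain U where U: "finite U" "card U = covering_number \<epsilon> D" "D \<subseteq> \<Union>U"
    "\<And>S x y. S \<in> U \<Longrightarrow> x \<in> S \<Longrightarrow> y \<in> S \<Longrightarrow> dist x y \<le> \<epsilon>"
    using covering_number_attained assms by metis
  obtain V where V: "finite V" "card V = covering_number \<epsilon> E" "E \<subseteq> \<Union>V"
    "\<And>S x y. S \<in> V \<Longrightarrow> x \<in> S \<Longrightarrow> y \<in> S \<Longrightarrow> dist x y \<le> \<epsilon>"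
    using covering_number_attained assms by metis
  let ?W = "(\<lambda>(S, T). S \<times> T) ` (U \<times> V)"
  have "covering_number (2 * \<epsilon>) (D \<times> E) \<le> card ?W"
  proof (rule covering_number_le)
    fix R x y assume "R \<in> ?W" "x \<in> R" "y \<in> R"
    then obtain S T where "S \<in> U" "T \<in> V" "fst x \<in> S" "fst y \<in> S" "snd x \<in> T" "snd y \<in> T"
      by auto
    then have "dist (fst x) (fst y) \<le> \<epsilon>" "dist (snd x) (snd y) \<le> \<epsilon>"
      using U(4) V(4) by auto
    \<comment> \<open>The factor 2 arises here: the Euclidean distance in a product is at most the
      sum of the two coordinate distances.\<close>
    moreover have "dist x y \<le> dist (fst x) (fst y) + dist (snd x) (snd y)"
      unfolding dist_prod_def by (rule sqrt_sum_squares_le_sum) auto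
    ultimately show "dist x y \<le> 2 * \<epsilon>" by linarith
  next
    show "D \<times> E \<subseteq> \<Union> ?W"
      using U(3) V(3) by fastforce
    show "finite ?W"
      using U(1) V(1) by (intro finite_imageI finite_cartesian_product)
  qed (use assms in auto)
  also have "\<dots> \<le> card (U \<times> V)"
    using U V by (intro card_image_le) auto
  finally show ?thesis
    using U V by (simp add: card_cartesian_product)
qed

lemma covering_number_atLeastAtMost:
  fixes a b :: real
  assumes "a \<le> b" "0 < \<epsilon>"
  shows "real (covering_number \<epsilon> {a..b}) \<le> (b - a) / \<epsilon> + 1"
proof -
  define n where "n = nat \<lfloor>(b - a) / \<epsilon>\<rfloor>"
  let ?I = "\<lambda>k. {a + real k * \<epsilon> .. a + (real k + 1) * \<epsilon>}"
  have n: "real n \<le> (b - a) / \<epsilon>"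
    using assms unfolding n_def by simp
  have "covering_number \<epsilon> {a..b} \<le> card (?I ` {..n})"
  proof (rule covering_number_le)
    show "{a..b} \<subseteq> \<Union> (?I ` {..n})"
    proof
      fix x assume x: "x \<in> {a..b}"
      define k where "k = nat \<lfloor>(x - a) / \<epsilon>\<rfloor>"
      have "real k \<le> (x - a) / \<epsilon>" "(x - a) / \<epsilon> \<le> real k + 1"
        using x assms unfolding k_def by auto
      then have "x \<in> ?I k"
        using assms by (auto simp: field_simps)
      moreover have "k \<le> n"
        unfolding k_def n_def using x assms by (intro nat_mono floor_mono divide_right_mono) auto
      ultimately show "x \<in> \<Union> (?I ` {..n})" by blast
    qed
  next
    fix S x y assume "S \<in> ?I ` {..n}" "x \<in> S" "y \<in> S"
    then show "dist x y \<le> \<epsilon>" by (auto simp: dist_real_def algebra_simps)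
  qed (use assms in auto)
  also have "\<dots> \<le> n + 1"
    using card_image_le[of "{..n}" ?I] by simp
  finally show ?thesis using n by linarith
qed

text \<open>The multiplicative constant contributes \<open>ln C / ln (1 / \<epsilon>)\<close>, which
  vanishes in the limit.\<close>

lemma upper_box_dim_le:
  fixes E :: "'a::euclidean_space set"
  assumes C: "1 \<le> C" and "0 < \<epsilon>0"
    and N: "\<And>\<epsilon>. 0 < \<epsilon> \<Longrightarrow> \<epsilon> < \<epsilon>0 \<Longrightarrow> real (covering_number \<epsilon> E) \<le> C * (1 / \<epsilon>) ^ s"
  shows "upper_box_dim E \<le> of_nat s"
proof -
  let ?g = "\<lambda>\<epsilon>. (ln C + real s * ln (1 / \<epsilon>)) / ln (1 / \<epsilon>)"
  have "upper_box_dim E \<le> Limsup (at_right 0) (\<lambda>\<epsilon>. ennreal (?g \<epsilon>))"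
    unfolding upper_box_dim_def
  proof (rule Limsup_mono)
    have "\<forall>\<^sub>F \<epsilon>::real in at_right 0. 0 < \<epsilon> \<and> \<epsilon> < min \<epsilon>0 1"
      using assms(2) eventually_at_right_real[of 0 "min \<epsilon>0 1"]
      by (auto elim!: eventually_mono)
    then show "\<forall>\<^sub>F \<epsilon> in at_right 0.
        ennreal (ln (real (covering_number \<epsilon> E)) / ln (1 / \<epsilon>)) \<le> ennreal (?g \<epsilon>)"
    proof eventually_elim
      case (elim \<epsilon>)
      then have pos: "0 < ln (1 / \<epsilon>)" by simp
      have "ln (real (covering_number \<epsilon> E)) \<le> ln C + real s * ln (1 / \<epsilon>)"
      proof (cases "covering_number \<epsilon> E = 0")
        \<comment> \<open>Here \<open>ln 0 = 0\<close>, and \<open>1 \<le> C\<close> keeps the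
          right-hand side nonnegative.\<close>
        case True
        then show ?thesis using C pos by simp
      next
        case False
        then have "ln (real (covering_number \<epsilon> E)) \<le> ln (C * (1 / \<epsilon>) ^ s)"
          using N[of \<epsilon>] elim C by (subst ln_le_cancel_iff) auto
        then show ?thesis
          using C elim by (simp add: ln_mult ln_realpow)
      qed
      then show ?case
        using pos by (intro ennreal_leI divide_right_mono) auto
    qed
  qed
  also have "\<dots> = ennreal (real s)"
  proof (rule lim_imp_Limsup)
    have "(?g \<longlongrightarrow> real s) (at_right 0)" by real_asymp
    then show "((\<lambda>\<epsilon>. ennreal (?g \<epsilon>)) \<longlongrightarrow> ennreal (real s)) (at_right 0)"
      by (rule tendsto_ennrealI)
  qed simp
  finally show ?thesis by (simp add: ennreal_of_nat_eq_real_of_nat)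
qed

lemma upper_box_dim_ge:
  fixes E :: "'a::euclidean_space set"
  assumes "0 < c"
    and N: "\<And>\<epsilon>. 0 < \<epsilon> \<Longrightarrow> c * (1 / \<epsilon>) ^ s \<le> real (covering_number \<epsilon> E)"
  shows "of_nat s \<le> upper_box_dim E"
proof -
  let ?g = "\<lambda>\<epsilon>. (ln c + real s * ln (1 / \<epsilon>)) / ln (1 / \<epsilon>)"
  have "of_nat s = ennreal (real s)" by (simp add: ennreal_of_nat_eq_real_of_nat)
  also have "\<dots> = Limsup (at_right 0) (\<lambda>\<epsilon>. ennreal (?g \<epsilon>))"
  proof (rule lim_imp_Limsup[symmetric])
    have "(?g \<longlongrightarrow> real s) (at_right 0)" by real_asymp
    then show "((\<lambda>\<epsilon>. ennreal (?g \<epsilon>)) \<longlongrightarrow> ennreal (real s)) (at_right 0)"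
      by (rule tendsto_ennrealI)
  qed simp
  also have "\<dots> \<le> upper_box_dim E"
    unfolding upper_box_dim_def
  proof (rule Limsup_mono)
    have "\<forall>\<^sub>F \<epsilon>::real in at_right 0. 0 < \<epsilon> \<and> \<epsilon> < 1"
      using eventually_at_right_real[of 0 1] by (auto elim!: eventually_mono)
    then show "\<forall>\<^sub>F \<epsilon> in at_right 0.
        ennreal (?g \<epsilon>) \<le> ennreal (ln (real (covering_number \<epsilon> E)) / ln (1 / \<epsilon>))"
    proof eventually_elim
      case (elim \<epsilon>)
      then have pos: "0 < ln (1 / \<epsilon>)" by simp
      have "ln (c * (1 / \<epsilon>) ^ s) \<le> ln (real (covering_number \<epsilon> E))"
        using N[of \<epsilon>] elim assms(1) by (intro ln_mono) auto
      then have "ln c + real s * ln (1 / \<epsilon>) \<le> ln (real (covering_number \<epsilon> E))"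
        using assms(1) elim by (simp add: ln_mult ln_realpow)
      then show ?case
        using pos by (intro ennreal_leI divide_right_mono) auto
    qed
  qed
  finally show ?thesis .
qed

text \<open>Volume comparison: a set of diameter at most \<open>\<epsilon>\<close> lies in the
  closed ball of radius \<open>\<epsilon>\<close> about any of its points, so the number of pieces
  times the volume of such a ball bounds the measure of \<open>E\<close>.\<close>

lemma upper_box_dim_positive_measure:
  fixes E :: "'a::euclidean_space set"
  assumes "bounded E" "measure lebesgue E > 0"
  shows "of_nat DIM('a) \<le> upper_box_dim E"
proof (rule upper_box_dim_ge)
  let ?w = "unit_ball_vol (real DIM('a))"
  show "0 < measure lebesgue E / ?w"
    using assms by simp
  fix \<epsilon> :: real assume "0 < \<epsilon>"
  obtain U where U: "finite U" "card U = covering_number \<epsilon> E" "E \<subseteq> \<Union>U"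
    "\<And>S x y. S \<in> U \<Longrightarrow> x \<in> S \<Longrightarrow> y \<in> S \<Longrightarrow> dist x y \<le> \<epsilon>"
    using covering_number_attained[OF assms(1) \<open>0 < \<epsilon>\<close>] by metis
  \<comment> \<open>A non-measurable set has \<open>measure\<close> 0 by convention, so positive
    measure forces measurability.\<close>
  have E: "E \<in> sets lebesgue"
    using assms(2) by (metis less_irrefl measure_notin_sets)
  define c where "c = (\<lambda>S::'a set. SOME x. x \<in> S)"
  have "E \<subseteq> (\<Union>S\<in>U. cball (c S) \<epsilon>)"
  proof
    fix x assume "x \<in> E"
    then obtain S where S: "S \<in> U" "x \<in> S" using U by auto
    then have "c S \<in> S" unfolding c_def by (metis someI)
    with S U(4) show "x \<in> (\<Union>S\<in>U. cball (c S) \<epsilon>)" by auto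
  qed
  then have "measure lebesgue E \<le> measure lebesgue (\<Union>S\<in>U. cball (c S) \<epsilon>)"
    using E U(1) by (intro measure_mono_fmeasurable fmeasurable.finite_UN) auto
  also have "\<dots> \<le> (\<Sum>S\<in>U. measure lebesgue (cball (c S) \<epsilon>))"
    using U(1) by (intro measure_UNION_le) auto
  also have "\<dots> = real (covering_number \<epsilon> E) * (?w * \<epsilon> ^ DIM('a))"
    using \<open>0 < \<epsilon>\<close> U(2) by (simp add: content_cball)
  finally show "measure lebesgue E / ?w * (1 / \<epsilon>) ^ DIM('a) \<le> real (covering_number \<epsilon> E)"
    using \<open>0 < \<epsilon>\<close> by (simp add: field_simps power_one_over)
qed

lemma upper_box_dim_nonexpansive_image:
  fixes f :: "'a::euclidean_space \<Rightarrow> 'b::euclidean_space"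
  assumes "1-lipschitz_on E f" "D \<subseteq> f ` E" "bounded E"
  shows "upper_box_dim D \<le> upper_box_dim E"
  unfolding upper_box_dim_def
proof (rule Limsup_mono)
  have "\<forall>\<^sub>F \<epsilon>::real in at_right 0. 0 < \<epsilon> \<and> \<epsilon> < 1"
    using eventually_at_right_real[of 0 1] by (auto elim!: eventually_mono)
  then show "\<forall>\<^sub>F \<epsilon> in at_right 0.
      ennreal (ln (real (covering_number \<epsilon> D)) / ln (1 / \<epsilon>))
      \<le> ennreal (ln (real (covering_number \<epsilon> E)) / ln (1 / \<epsilon>))"
  proof eventually_elim
    case (elim \<epsilon>)
    have *: "covering_number \<epsilon> D \<le> covering_number \<epsilon> E"
      using covering_number_lipschitz_image[OF assms(1) _ assms(2) _ assms(3), of \<epsilon>] elim by simp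
    have "ln (real (covering_number \<epsilon> D)) \<le> ln (real (covering_number \<epsilon> E))"
    proof (cases "covering_number \<epsilon> D = 0")
      case True
      then show ?thesis
        by (cases "covering_number \<epsilon> E = 0") (auto intro!: ln_ge_zero)
    next
      case False
      with * show ?thesis by (intro ln_mono) auto
    qed
    then show ?case
      using elim by (intro ennreal_leI divide_right_mono) auto
  qed
qed

lemma upper_box_dim_square_le:
  assumes "E \<subseteq> {0..1::real} \<times> {0..1::real}"
  shows "upper_box_dim E \<le> 2"
proof -
  let ?Q = "{0..1::real} \<times> {0..1::real}"
  have "upper_box_dim E \<le> of_nat 2"
  proof (rule upper_box_dim_le)
    fix \<epsilon> :: real assume \<epsilon>: "0 < \<epsilon>" "\<epsilon> < 1"
    have "covering_number (1 * \<epsilon>) E \<le> covering_number \<epsilon> ?Q"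
      using assms \<epsilon> by (intro covering_number_lipschitz_image[where f = id])
        (auto intro: bounded_Times simp: lipschitz_on_def)
    also have "\<dots> \<le> covering_number (\<epsilon> / 2) {0..1::real} * covering_number (\<epsilon> / 2) {0..1::real}"
      using covering_number_Times[of "{0..1::real}" "{0..1::real}" "\<epsilon> / 2"] \<epsilon> by simp
    finally have "real (covering_number \<epsilon> E)
      \<le> real (covering_number (\<epsilon> / 2) {0..1::real} * covering_number (\<epsilon> / 2) {0..1::real})"
      by (simp only: mult_1 of_nat_le_iff)
    \<comment> \<open>For \<open>\<epsilon> < 1\<close> the interval count
      \<open>2 / \<epsilon> + 1\<close> is at most \<open>3 / \<epsilon>\<close>.\<close>
    also have "\<dots> \<le> (3 / \<epsilon>) * (3 / \<epsilon>)"
    proof -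
      have "real (covering_number (\<epsilon> / 2) {0..1::real}) \<le> 3 / \<epsilon>"
        using covering_number_atLeastAtMost[of 0 1 "\<epsilon> / 2"] \<epsilon> by (simp add: field_simps)
      then show ?thesis
        unfolding of_nat_mult using \<epsilon> by (intro mult_mono) auto
    qed
    finally show "real (covering_number \<epsilon> E) \<le> 9 * (1 / \<epsilon>) ^ 2"
      by (simp add: power2_eq_square field_simps)
  qed auto
  then show ?thesis by simp
qed

section \<open>Directional contributions and cross dimension\<close>

lemma pbox_dim_le:
  assumes "upper_box_dim (E \<inter> ball x 1) \<le> d"
  shows "pbox_dim x E \<le> d"
  unfolding pbox_dim_def
  using assms by (auto intro: INF_lower2[where i = 1])

lemma pbox_dim_ge:
  assumes "x \<in> closure E" "\<And>r. 0 < r \<Longrightarrow> d \<le> upper_box_dim (E \<inter> ball x r)"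
  shows "d \<le> pbox_dim x E"
  unfolding pbox_dim_def using assms by (auto intro!: INF_greatest)

text \<open>The parameter interval is covered at scale \<open>\<epsilon> / M\<close> and the cover
  is transported along the curve, so the count grows at most linearly in
  \<open>1 / \<epsilon>\<close>.\<close>

lemma upper_box_dim_lipschitz_curve_le:
  fixes \<gamma> :: "real \<Rightarrow> 'a::euclidean_space"
  assumes "L-lipschitz_on {0..\<delta>} \<gamma>" "0 \<le> \<delta>" "D \<subseteq> \<gamma> ` {0..\<delta>}"
  shows "upper_box_dim D \<le> 1"
proof -
  \<comment> \<open>\<open>L\<close> may be 0; the larger constant is positive and can be divided
    by.\<close>
  define M where "M = L + 1"
  have L: "M-lipschitz_on {0..\<delta>} \<gamma>" "0 < M"
    using lipschitz_on_le[OF assms(1), of M] lipschitz_on_nonneg[OF assms(1)] by (auto simp: M_def)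
  have "upper_box_dim D \<le> of_nat 1"
  proof (rule upper_box_dim_le)
    show "1 \<le> \<delta> * M + 1" using assms L by simp
    fix \<epsilon> :: real assume \<epsilon>: "0 < \<epsilon>" "\<epsilon> < 1"
    have "covering_number (M * (\<epsilon> / M)) D \<le> covering_number (\<epsilon> / M) {0..\<delta>}"
      using L \<epsilon> assms(3) by (intro covering_number_lipschitz_image) auto
    then have "covering_number \<epsilon> D \<le> covering_number (\<epsilon> / M) {0..\<delta>}"
      using L by simp
    also have "real \<dots> \<le> (\<delta> - 0) / (\<epsilon> / M) + 1"
      using L \<epsilon> assms by (intro covering_number_atLeastAtMost) auto
    also have "\<dots> \<le> (\<delta> * M + 1) * (1 / \<epsilon>) ^ 1"
      using \<epsilon> L by (simp add: field_simps)
    finally show "real (covering_number \<epsilon> D) \<le> (\<delta> * M + 1) * (1 / \<epsilon>) ^ 1" by simp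
  qed simp
  then show ?thesis by simp
qed

lemma dir_contrib_le_1: "dir_contrib x A v \<le> 1"
  unfolding dir_contrib_def
proof (intro SUP_least, clarify)
  fix \<delta> \<gamma> assume "(\<delta>, \<gamma>) \<in> probes A x v"
  then obtain L where "L-lipschitz_on {0..\<delta>} \<gamma>" "0 < \<delta>"
    by (auto simp: probes_def)
  then show "pbox_dim x (A \<inter> \<gamma> ` {0..\<delta>}) \<le> 1"
    by (intro pbox_dim_le upper_box_dim_lipschitz_curve_le[of L \<delta> \<gamma>]) auto
qed

lemma proj_dir_contrib_le_1: "proj_dir_contrib x A \<xi> \<le> 1"
  unfolding proj_dir_contrib_def by (intro SUP_least dir_contrib_le_1)

lemma cross_dim_le: "cross_dim x (A :: 'a::euclidean_space set) \<le> of_nat DIM('a)"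
  unfolding cross_dim_def
proof (intro SUP_least, clarify)
  fix m and \<xi> :: "nat \<Rightarrow> 'a set"
  assume m: "m \<le> DIM('a)"
  have "(\<Sum>i=1..m. proj_dir_contrib x A (\<xi> i)) \<le> (\<Sum>i=1..m. 1)"
    by (intro sum_mono proj_dir_contrib_le_1)
  also have "\<dots> = of_nat m" by simp
  also have "\<dots> \<le> of_nat DIM('a)" using m by (rule of_nat_mono)
  finally show "(\<Sum>i=1..m. proj_dir_contrib x A (\<xi> i)) \<le> of_nat DIM('a)" .
qed

lemma cross_dim_ge:
  fixes A :: "'a::euclidean_space set"
  assumes "set vs \<subseteq> eff_dirs x A" "distinct vs" "independent (set vs)"
    and contrib: "\<And>v. v \<in> set vs \<Longrightarrow> 1 \<le> dir_contrib x A v"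
  shows "of_nat (length vs) \<le> cross_dim x A"
proof -
  \<comment> \<open>The families in \<open>cross_dim\<close> are indexed from 1, list entries from
    0.\<close>
  let ?w = "\<lambda>i. vs ! (i - 1)" and ?m = "length vs"
  let ?\<xi> = "\<lambda>i. span {?w i}"
  have "{1..?m} = Suc ` {..<?m}" by (simp add: image_Suc_lessThan)
  then have img: "?w ` {1..?m} = set vs"
    by (auto simp: set_conv_nth image_image simp del: image_Suc_lessThan)
  have "proj_independent ?m ?\<xi>"
    unfolding proj_independent_def
  proof (intro exI[of _ ?w] conjI ballI)
    show "?w i \<noteq> 0" if "i \<in> {1..?m}" for i
      using that img assms(3) dependent_zero by (metis imageI)
    show "inj_on ?w {1..?m}"
      using assms(2) by (auto simp: inj_on_def nth_eq_iff_index_eq)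
  qed (use img assms in simp_all)
  moreover have "?m \<le> DIM('a)"
    using independent_bound[OF assms(3)] distinct_card[OF assms(2)] by simp
  moreover have dirs: "?w i \<in> eff_dirs x A" "?w i \<in> set vs" if "i \<in> {1..?m}" for i
    using that assms(1) by auto
  ultimately have "(\<Sum>i=1..?m. proj_dir_contrib x A (?\<xi> i)) \<le> cross_dim x A"
    unfolding cross_dim_def proj_eff_dirs_def
    by (intro SUP_upper2[where i = "(?m, ?\<xi>)"]) auto
  moreover have "1 \<le> proj_dir_contrib x A (?\<xi> i)" if "i \<in> {1..?m}" for i
    unfolding proj_dir_contrib_def using dirs[OF that] contrib
    by (intro SUP_upper2[where i = "?w i"]) auto
  then have "(\<Sum>i=1..?m. 1) \<le> (\<Sum>i=1..?m. proj_dir_contrib x A (?\<xi> i))"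
    by (intro sum_mono) auto
  ultimately show ?thesis by simp
qed

text \<open>The ray from \<open>z\<close> in direction \<open>v\<close> serves twice. Positive
  length near 0 supplies points of \<open>A\<close> on the ray arbitrarily close to
  \<open>z\<close>, which makes \<open>v\<close> a tangent direction; the same positive length gives
  the ray, taken as a probe, dimension at least 1.\<close>

lemma line_positive_measure:
  fixes A :: "'a::euclidean_space set"
  assumes v: "norm v = 1"
    and pos: "\<And>\<eta>. 0 < \<eta> \<Longrightarrow> measure lebesgue ({t. z + t *\<^sub>R v \<in> A} \<inter> {0<..<\<eta>}) > 0"
  shows line_in_eff_dirs: "v \<in> eff_dirs z A"
    and line_dir_contrib: "1 \<le> dir_contrib z A v"
proof -
  let ?\<gamma> = "\<lambda>t. z + t *\<^sub>R v"
  define S where "S = {t. ?\<gamma> t \<in> A}"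
  have pos: "0 < measure lebesgue (S \<inter> {0<..<\<eta>})" if "0 < \<eta>" for \<eta>
    using pos[OF that] by (simp add: S_def)
  have ex: "\<exists>t. t \<in> S \<and> 0 < t \<and> t < \<eta>" if "0 < \<eta>" for \<eta>
  proof -
    have "S \<inter> {0<..<\<eta>} \<noteq> {}"
      using pos[OF that] by (metis measure_empty less_irrefl)
    then show ?thesis by auto
  qed
  \<comment> \<open>\<open>tangent_cone\<close> asks for decreasing scales. Strictly decreasing
    parameters serve both as scales and as positions, so every difference quotient equals
    \<open>v\<close>.\<close>
  have "\<exists>l. \<forall>n::nat. (l n \<in> S \<and> 0 < l n \<and> l n < 1 / real (Suc n)) \<and> l (Suc n) < l n"
  proof (rule dependent_nat_choice)
    show "\<exists>t. t \<in> S \<and> 0 < t \<and> t < 1 / real (Suc 0)" by (rule ex) simp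
    fix t n assume "t \<in> S \<and> 0 < t \<and> t < 1 / real (Suc n)"
    then show "\<exists>s. (s \<in> S \<and> 0 < s \<and> s < 1 / real (Suc (Suc n))) \<and> s < t"
      using ex[of "min t (1 / real (Suc (Suc n)))"] by auto
  qed
  then obtain l where l: "\<And>n. l n \<in> S" "\<And>n. 0 < l n" "\<And>n. l n < 1 / real (Suc n)"
    "\<And>n. l (Suc n) < l n" by blast
  have lim: "l \<longlonglongrightarrow> 0"
    by (rule tendsto_sandwich[OF _ _ tendsto_const LIMSEQ_inverse_real_of_nat])
      (use l in \<open>auto intro!: always_eventually less_imp_le simp: inverse_eq_divide\<close>)
  have limz: "(\<lambda>n. ?\<gamma> (l n)) \<longlonglongrightarrow> z"
    using tendsto_add[OF tendsto_const tendsto_scaleR[OF lim tendsto_const], of z v] by simp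
  have clA: "z \<in> closure A"
    unfolding closure_sequential using l(1) limz
    by (intro exI[of _ "\<lambda>n. ?\<gamma> (l n)"]) (auto simp: S_def)
  have "v \<in> tangent_cone z A"
    unfolding tangent_cone_def
  proof (intro CollectI exI conjI allI)
    show "?\<gamma> (l n) \<in> A" "0 < l n" for n using l by (auto simp: S_def)
    show "decseq l" using l(4) by (intro decseq_SucI) (simp add: less_imp_le)
    have "(?\<gamma> (l n) - z) /\<^sub>R l n = v" for n
      using l(2)[of n] by simp
    then show "(\<lambda>n. (?\<gamma> (l n) - z) /\<^sub>R l n) \<longlonglongrightarrow> v" by simp
  qed (fact limz lim)+
  with clA v show "v \<in> eff_dirs z A" by (simp add: eff_dirs_def)

  have probe: "(1, ?\<gamma>) \<in> probes A z v"
    unfolding probes_def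
  proof (intro CollectI, simp only: prod.case, intro conjI ballI)
    show "inj_on ?\<gamma> {0..1}" using v by (auto simp: inj_on_def)
    show "\<exists>L. L-lipschitz_on {0..1} ?\<gamma>"
      using v by (intro exI[of _ 1] lipschitz_onI)
        (auto simp: dist_norm dist_real_def simp flip: scaleR_left_diff_distrib)
    have "\<forall>\<^sub>F t::real in at_right 0. v = (?\<gamma> t - z) /\<^sub>R norm (?\<gamma> t - z)"
      using eventually_at_right_less by eventually_elim (use v in simp)
    then show "((\<lambda>t. (?\<gamma> t - z) /\<^sub>R norm (?\<gamma> t - z)) \<longlongrightarrow> v) (at_right 0)"
      by (rule tendsto_eventually[OF eventually_mono]) simp
    show "A \<inter> ?\<gamma> ` {0<..\<eta>} \<noteq> {}" if "\<eta> \<in> {0<..1}" for \<eta>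
      using ex[of \<eta>] that by (force simp: S_def)
  qed auto
  have "1 \<le> pbox_dim z (A \<inter> ?\<gamma> ` {0..1})" (is "_ \<le> pbox_dim z ?E")
  proof (rule pbox_dim_ge)
    have "l n \<le> 1" for n
      using l(3)[of n] by (rule order.trans[OF less_imp_le]) (simp add: field_simps)
    then have "?\<gamma> (l n) \<in> ?E" for n
      using l(1,2)[of n] by (auto simp: S_def less_imp_le)
    then show "z \<in> closure ?E"
      unfolding closure_sequential using limz by (intro exI[of _ "\<lambda>n. ?\<gamma> (l n)"]) auto
    fix r :: real assume r: "0 < r"
    let ?D = "S \<inter> {0<..<min r 1}"
    have "of_nat DIM(real) \<le> upper_box_dim ?D"
      using pos[of "min r 1"] r
      by (intro upper_box_dim_positive_measure bounded_subset[of "{0<..<min r 1}" ?D]) auto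
    also have "\<dots> \<le> upper_box_dim (?E \<inter> ball z r)"
    \<comment> \<open>This projection recovers the parameter from a point of the ray and is
      1-Lipschitz by Cauchy-Schwarz. The parameter set on the real line therefore has dimension no
      larger than its trace on the ray.\<close>
    proof (rule upper_box_dim_nonexpansive_image[where f = "\<lambda>y. (y - z) \<bullet> v"])
      have "dist ((x - z) \<bullet> v) ((y - z) \<bullet> v) \<le> 1 * dist x y" for x y
        using Cauchy_Schwarz_ineq2[of "x - y" v] v
        by (simp add: dist_real_def dist_norm flip: inner_diff_left)
      then show "1-lipschitz_on (?E \<inter> ball z r) (\<lambda>y. (y - z) \<bullet> v)"
        by (intro lipschitz_onI) auto
      show "?D \<subseteq> (\<lambda>y. (y - z) \<bullet> v) ` (?E \<inter> ball z r)"
      proof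
        fix t assume t: "t \<in> ?D"
        then have "?\<gamma> t \<in> ?E \<inter> ball z r"
          using v by (auto simp: S_def dist_norm)
        moreover have "t = (?\<gamma> t - z) \<bullet> v"
          using v by (simp add: dot_square_norm)
        ultimately show "t \<in> (\<lambda>y. (y - z) \<bullet> v) ` (?E \<inter> ball z r)" by blast
      qed
    qed (auto intro: bounded_subset[OF bounded_ball])
    finally show "1 \<le> upper_box_dim (?E \<inter> ball z r)" by simp
  qed
  then show "1 \<le> dir_contrib z A v"
    unfolding dir_contrib_def using probe by (intro SUP_upper2[where i = "(1, ?\<gamma>)"]) auto
qed

section \<open>Lebesgue density\<close>

text \<open>
  The hypothesis contracts outer measure: Vitali's theorem replaces a measurable superset of \<open>S\<close>
  by one whose measure is smaller by a factor arbitrarily close to \<open>c\<close>.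
\<close>

lemma negligible_low_density:
  fixes F S :: "'a::euclidean_space set"
  assumes F: "F \<in> lmeasurable" "S \<subseteq> F" and c: "0 \<le> c" "c < 1"
    and low: "\<And>x d. x \<in> S \<Longrightarrow> 0 < d \<Longrightarrow>
      \<exists>r. 0 < r \<and> r < d \<and> measure lebesgue (F \<inter> ball x r) \<le> c * measure lebesgue (ball x r)"
  shows "negligible S"
proof -
  let ?\<mu> = "measure lebesgue :: 'a set \<Rightarrow> real"
  let ?T = "{T \<in> lmeasurable. S \<subseteq> T}"
  \<comment> \<open>\<open>m\<close> is the outer measure of \<open>S\<close>. The goal is
    \<open>m \<le> 0\<close>, reached through \<open>m \<le> c * ?\<mu> T\<close> for every
    competitor \<open>T\<close>.\<close>
  define m where "m = Inf (?\<mu> ` ?T)"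
  have bdd: "bdd_below (?\<mu> ` ?T)"
    by (intro bdd_belowI[of _ 0]) auto
  have ne: "?\<mu> ` ?T \<noteq> {}" using F by auto
  have contract: "m \<le> c * (?\<mu> T + e)" if T: "T \<in> ?T" and "0 < e" for T e
  proof -
    have T': "T \<in> lmeasurable" "S \<subseteq> T" using T by auto
    obtain U where U: "open U" "T \<subseteq> U" "U - T \<in> lmeasurable" "emeasure lebesgue (U - T) < ennreal e"
      using sets_lebesgue_outer_open[OF _ \<open>0 < e\<close>] T' by (metis fmeasurableD)
    have eqU: "U = T \<union> (U - T)" using U by auto
    have Um: "U \<in> lmeasurable"
      using T' U eqU by (metis fmeasurable.Un)
    have "?\<mu> (U - T) \<le> e"
      using U \<open>0 < e\<close> by (simp add: emeasure_eq_measure2 ennreal_less_iff)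
    then have Ue: "?\<mu> U \<le> ?\<mu> T + e"
      using measure_Un_le[of T lebesgue "U - T"] T' U eqU by (simp add: fmeasurableD)
    \<comment> \<open>Balls of low density inside the open set \<open>U\<close>, whose measure
      exceeds that of \<open>T\<close> by at most \<open>e\<close>. Arbitrarily small ones are
      centred at each point of \<open>S\<close>, so Vitali's theorem applies.\<close>
    let ?K = "{(x, r). 0 < r \<and> ball x r \<subseteq> U \<and> ?\<mu> (F \<inter> ball x r) \<le> c * ?\<mu> (ball x r)}"
    have cov: "\<exists>i. i \<in> ?K \<and> x \<in> ball (fst i) (snd i) \<and> snd i < d" if x: "x \<in> S" "0 < d" for x d
    proof -
      have "x \<in> U" using x T' U by auto
      then obtain k where k: "0 < k" "ball x k \<subseteq> U"
        using U(1) by (meson openE)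
      obtain r where "0 < r" "r < min d k" "?\<mu> (F \<inter> ball x r) \<le> c * ?\<mu> (ball x r)"
        using low[OF x(1), of "min d k"] x k by auto
      then show ?thesis
        using k subset_ball[of r k x] by (intro exI[of _ "(x, r)"]) auto
    qed
    obtain C where C: "countable C" "C \<subseteq> ?K"
      "pairwise (\<lambda>i j. disjnt (ball (fst i) (snd i)) (ball (fst j) (snd j))) C"
      "negligible (S - (\<Union>i\<in>C. ball (fst i) (snd i)))" (is "negligible ?N")
      by (rule Vitali_covering_theorem_balls[of S ?K fst snd, OF cov])
    \<comment> \<open>Since \<open>S \<subseteq> F\<close>, the parts of the chosen balls inside
      \<open>F\<close> already cover \<open>S\<close> up to the null set \<open>?N\<close>. Hence
      \<open>?V \<union> ?N\<close> is a new competitor.\<close>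
    let ?V = "\<Union>i\<in>C. F \<inter> ball (fst i) (snd i)"
    have meas: "F \<inter> ball (fst i) (snd i) \<in> lmeasurable" for i :: "'a \<times> real"
      using F by (simp add: fmeasurable_Int_fmeasurable fmeasurableD)
    have bound: "?\<mu> (\<Union>i\<in>J. F \<inter> ball (fst i) (snd i)) \<le> c * (?\<mu> T + e)"
      if J: "J \<subseteq> C" "finite J" for J
    proof -
      have "?\<mu> (\<Union>i\<in>J. F \<inter> ball (fst i) (snd i)) \<le> (\<Sum>i\<in>J. ?\<mu> (F \<inter> ball (fst i) (snd i)))"
        using J meas by (intro measure_UNION_le) (auto dest: fmeasurableD)
      also have "\<dots> \<le> (\<Sum>i\<in>J. c * ?\<mu> (ball (fst i) (snd i)))"
        using J C(2) by (intro sum_mono) auto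
      \<comment> \<open>Disjointness of the balls turns the sum of their measures into the measure
        of their union, which lies in \<open>U\<close>.\<close>
      also have "\<dots> = c * ?\<mu> (\<Union>i\<in>J. ball (fst i) (snd i))"
        using J C(3) by (subst measure_UNION') (auto simp: sum_distrib_left elim: pairwise_subset)
      also have "?\<mu> (\<Union>i\<in>J. ball (fst i) (snd i)) \<le> ?\<mu> U"
        using J C(2) Um by (intro measure_mono_fmeasurable sets.finite_UN) fastforce+
      also have "?\<mu> U \<le> ?\<mu> T + e" by (rule Ue)
      finally show ?thesis using c by (simp add: mult_left_mono)
    qed
    have V: "?V \<in> lmeasurable" "?\<mu> ?V \<le> c * (?\<mu> T + e)"
      using fmeasurable_UN_bound[OF C(1) meas bound] measure_UN_bound[OF C(1) meas bound] by auto
    have N: "?N \<in> lmeasurable" "?\<mu> ?N = 0"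
      using C(4) by (auto simp: negligible_imp_measurable negligible_imp_measure0)
    have "?V \<union> ?N \<in> ?T"
      using V N F(2) by (auto intro!: fmeasurable.Un)
    then have "m \<le> ?\<mu> (?V \<union> ?N)"
      unfolding m_def using bdd by (intro cInf_lower) auto
    also have "\<dots> \<le> ?\<mu> ?V + ?\<mu> ?N"
      using V N by (intro measure_Un_le) (auto dest: fmeasurableD)
    finally show ?thesis using V N by linarith
  qed
  have contract': "m \<le> c * ?\<mu> T" if "T \<in> ?T" for T
  proof (rule field_le_epsilon)
    fix e :: real assume "0 < e"
    then have "m \<le> c * (?\<mu> T + e)" by (rule contract[OF that])
    also have "\<dots> \<le> c * ?\<mu> T + e"
      using c \<open>0 < e\<close> by (simp add: algebra_simps mult_left_le_one_le)
    finally show "m \<le> c * ?\<mu> T + e" .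
  qed
  have "m \<le> 0"
  proof (rule ccontr)
    assume "\<not> m \<le> 0"
    \<comment> \<open>If \<open>m > 0\<close> and \<open>c > 0\<close>, some competitor has measure
      below \<open>m / c\<close>, and contraction gives \<open>m < m\<close>. If
      \<open>c = 0\<close>, contraction applied to \<open>F\<close> already gives
      \<open>m \<le> 0\<close>.\<close>
    then have "m < m / c \<or> c = 0" using c by (auto simp: field_simps)
    moreover have "c \<noteq> 0" using contract'[of F] F \<open>\<not> m \<le> 0\<close> by auto
    ultimately obtain T where T: "T \<in> ?T" "?\<mu> T < m / c"
      using cInf_lessD[OF ne, of "m / c"] by (auto simp: m_def)
    then show False
      using contract'[OF T(1)] c \<open>c \<noteq> 0\<close> by (auto simp: field_simps)
  qed
  show ?thesis
    unfolding negligible_outer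
  proof (intro allI impI)
    fix e :: real assume "0 < e"
    then show "\<exists>T. S \<subseteq> T \<and> T \<in> lmeasurable \<and> ?\<mu> T < e"
      using cInf_lessD[OF ne, of e] \<open>m \<le> 0\<close> by (auto simp: m_def)
  qed
qed

text \<open>The density ratio never exceeds 1, so convergence can fail only if, for some
  \<open>n\<close>, it is at most \<open>1 - 1 / real (Suc n)\<close> at arbitrarily small radii.
  The exceptional set is thus covered by countably many sets of low density.\<close>

theorem lebesgue_density:
  fixes F :: "'a::euclidean_space set"
  assumes F: "F \<in> lmeasurable"
  shows "negligible {x \<in> F. \<not> ((\<lambda>r. measure lebesgue (F \<inter> ball x r) / measure lebesgue (ball x r))
           \<longlongrightarrow> 1) (at_right 0)}"
proof -
  let ?\<mu> = "measure lebesgue :: 'a set \<Rightarrow> real"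
  let ?q = "\<lambda>x r. ?\<mu> (F \<inter> ball x r) / ?\<mu> (ball x r)"
  define S where "S n = {x \<in> F. \<forall>d>0. \<exists>r. 0 < r \<and> r < d \<and>
      ?\<mu> (F \<inter> ball x r) \<le> (1 - 1 / real (Suc n)) * ?\<mu> (ball x r)}" for n
  have "negligible (S n)" for n
    by (rule negligible_low_density[OF F, of _ "1 - 1 / real (Suc n)"]) (auto simp: S_def field_simps)
  moreover have "{x \<in> F. \<not> (?q x \<longlongrightarrow> 1) (at_right 0)} \<subseteq> (\<Union>n. S n)"
  proof (rule ccontr)
    assume "\<not> ?thesis"
    then obtain x where x: "x \<in> F" "\<not> (?q x \<longlongrightarrow> 1) (at_right 0)" "\<And>n. x \<notin> S n" by auto
    have "(?q x \<longlongrightarrow> 1) (at_right 0)"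
    proof (rule order_tendstoI)
      fix a :: real assume "a < 1"
      then obtain n where n: "1 / real (Suc n) < 1 - a"
        using reals_Archimedean[of "1 - a"] by (auto simp: inverse_eq_divide)
      obtain d where d: "0 < d" "\<And>r. 0 < r \<Longrightarrow> r < d \<Longrightarrow>
          (1 - 1 / real (Suc n)) * ?\<mu> (ball x r) < ?\<mu> (F \<inter> ball x r)"
        using x(1) x(3)[of n] by (auto simp: S_def not_le)
      show "\<forall>\<^sub>F r in at_right 0. a < ?q x r"
        using eventually_at_right_real[OF d(1)]
      proof eventually_elim
        case (elim r)
        then have pos: "0 < ?\<mu> (ball x r)" by (simp add: content_ball_pos)
        have "a * ?\<mu> (ball x r) \<le> (1 - 1 / real (Suc n)) * ?\<mu> (ball x r)"
          using n pos by (intro mult_right_mono) auto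
        also have "\<dots> < ?\<mu> (F \<inter> ball x r)" using d(2) elim by simp
        finally show "a < ?q x r" using pos by (simp add: pos_less_divide_eq)
      qed
    next
      fix a :: real assume "1 < a"
      have "?\<mu> (F \<inter> ball x r) \<le> ?\<mu> (ball x r)" for r
        using F by (intro measure_mono_fmeasurable) (auto dest: fmeasurableD)
      then have q: "?q x r \<le> 1" for r
        unfolding divide_le_eq_1 by (metis less_le measure_nonneg)
      then show "\<forall>\<^sub>F r in at_right 0. ?q x r < a"
        using le_less_trans[OF q \<open>1 < a\<close>] by (intro always_eventually allI)
    qed
    with x(2) show False by blast
  qed
  ultimately show ?thesis
    using negligible_Union_nat[of S] negligible_subset by blast
qed

text \<open>Once the density ratio exceeds 1/2, \<open>F\<close> has measure more than
  \<open>r\<close> in an interval of length \<open>2 * r\<close>. The left half accounts for at most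
  \<open>r\<close>, so the right half must carry some.\<close>

lemma density_point_one_sided:
  assumes F: "F \<in> sets lebesgue" and p: "p \<in> density_points F" and "0 < \<eta>"
  shows "0 < measure lebesgue (F \<inter> {p<..<p + \<eta>})"
proof -
  have lim: "((\<lambda>r. measure lebesgue (F \<inter> {p - r<..<p + r}) / (2 * r)) \<longlongrightarrow> 1) (at_right 0)"
    using p by (simp add: density_points_def)
  have "\<forall>\<^sub>F r in at_right 0. 1 / 2 < measure lebesgue (F \<inter> {p - r<..<p + r}) / (2 * r) \<and> r \<in> {0<..<\<eta>}"
    using order_tendstoD(1)[OF lim, of "1/2"] eventually_at_right_real[OF \<open>0 < \<eta>\<close>]
    by (auto intro: eventually_conj)
  from eventually_happens'[OF _ this]
  obtain r where r: "0 < r" "r < \<eta>" "1 / 2 < measure lebesgue (F \<inter> {p - r<..<p + r}) / (2 * r)"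
    by (auto simp del: divide_le_eq_numeral1 less_divide_eq_numeral1)
  have meas: "F \<inter> {a<..<b} \<in> lmeasurable" for a b
    using F by (metis fmeasurable_Int_fmeasurable inf_commute lmeasurable_box box_real(1))
  have "r < measure lebesgue (F \<inter> {p - r<..<p + r})"
    using r by (simp add: field_simps)
  also have "\<dots> \<le> measure lebesgue ({p - r..p} \<union> (F \<inter> {p<..<p + \<eta>}))"
    using r F by (intro measure_mono_fmeasurable fmeasurable.Un meas)
      (auto simp: fmeasurableD[OF meas])
  also have "\<dots> \<le> measure lebesgue {p - r..p} + measure lebesgue (F \<inter> {p<..<p + \<eta>})"
    using meas by (intro measure_Un_le) (auto dest: fmeasurableD)
  also have "measure lebesgue {p - r..p} = r" using r by simp
  finally show ?thesis by simp
qed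

section \<open>Product measures and null sets\<close>

lemma measure_lebesgue_Times:
  fixes S :: "'a::euclidean_space set" and T :: "'b::euclidean_space set"
  assumes "S \<in> sets borel" "T \<in> sets borel"
  shows "measure lebesgue (S \<times> T) = measure lebesgue S * measure lebesgue T"
proof -
  have "emeasure lborel (S \<times> T) = emeasure lborel S * emeasure lborel T"
    using assms by (simp add: lborel_prod[symmetric] lborel.emeasure_pair_measure_Times)
  then show ?thesis
    using assms by (simp add: measure_def enn2real_mult borel_Times)
qed

text \<open>A Lebesgue null set lies in a Borel null set, whose product with the whole space is null
  for the product of the Borel measures. Completeness passes this to the subset.\<close>

lemma null_sets_lebesgue_Times:
  fixes N :: "'a::euclidean_space set"
  assumes "N \<in> null_sets lebesgue"
  shows "N \<times> (UNIV :: 'b::euclidean_space set) \<in> null_sets lebesgue"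
    and "(UNIV :: 'b set) \<times> N \<in> null_sets lebesgue"
proof -
  obtain M where M: "M \<in> null_sets lborel" "N \<subseteq> M"
    using assms by (auto simp: null_sets_completion_iff2)
  have "M \<times> (UNIV :: 'b set) \<in> null_sets lborel" "(UNIV :: 'b set) \<times> M \<in> null_sets lborel"
    unfolding lborel_prod[symmetric]
    using M lborel.times_in_null_sets1[of M lborel "UNIV :: 'b set"]
      lborel.times_in_null_sets2[of "UNIV :: 'b set" lborel M] by auto
  moreover have "N \<times> UNIV \<subseteq> M \<times> UNIV" "UNIV \<times> N \<subseteq> UNIV \<times> M"
    using M(2) by auto
  ultimately show "N \<times> (UNIV :: 'b set) \<in> null_sets lebesgue"
    "(UNIV :: 'b set) \<times> N \<in> null_sets lebesgue"
    unfolding null_sets_completion_iff2 by (metis (no_types))+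
qed

lemma negligible_nondensity_points:
  assumes "F \<in> lmeasurable"
  shows "negligible (F - density_points F)"
proof -
  have "((\<lambda>r. measure lebesgue (F \<inter> {p - r<..<p + r}) / (2 * r)) \<longlongrightarrow> 1) (at_right 0) \<longleftrightarrow>
    ((\<lambda>r. measure lebesgue (F \<inter> ball p r) / measure lebesgue (ball p r)) \<longlongrightarrow> 1) (at_right 0)" for p
    by (rule filterlim_cong[OF refl refl eventually_mono[OF eventually_at_right_less]])
      (simp add: ball_eq_greaterThanLessThan)
  then have "F - density_points F = {x \<in> F. \<not> ((\<lambda>r. measure lebesgue (F \<inter> ball x r)
      / measure lebesgue (ball x r)) \<longlongrightarrow> 1) (at_right 0)}"
    unfolding density_points_def by auto
  with lebesgue_density[OF assms] show ?thesis by simp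
qed

lemma density_points_subset: "density_points F \<subseteq> F"
  by (auto simp: density_points_def)

section \<open>Dimensions of \<open>F \<times> F\<close> at pairs of density points\<close>

theorem proposition4p61:
  fixes F :: "real set"
  assumes "F \<subseteq> {0..1}" and "fat_cantor F"
  shows "(\<forall>p\<in>density_points F. \<forall>q\<in>density_points F.
            pbox_dim (p, q) (F \<times> F) = 2 \<and> cross_dim (p, q) (F \<times> F) = 2) \<and>
         density_points F \<times> density_points F \<subseteq> F \<times> F \<and>
         F \<times> F - density_points F \<times> density_points F \<in> null_sets lebesgue \<and>
         (\<forall>z\<in>density_points F \<times> density_points F.
            pbox_dim z (F \<times> F) = cross_dim z (F \<times> F))"
proof -
  let ?D = "density_points F"
  have "compact F" using assms(2) by (simp add: fat_cantor_def)
  then have F: "F \<in> sets borel" "F \<in> lmeasurable"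
    by (auto simp: borel_compact lmeasurable_compact)
  note pos = density_point_one_sided[OF fmeasurableD[OF F(2)]]
  have pbox: "pbox_dim (p, q) (F \<times> F) = 2" if "p \<in> ?D" "q \<in> ?D" for p q
  proof (rule antisym)
    show "pbox_dim (p, q) (F \<times> F) \<le> 2"
      using assms(1) by (intro pbox_dim_le upper_box_dim_square_le) auto
    show "2 \<le> pbox_dim (p, q) (F \<times> F)"
    proof (rule pbox_dim_ge)
      show "(p, q) \<in> closure (F \<times> F)"
        using that closure_subset[of "F \<times> F"] by (auto simp: density_points_def)
      fix r :: real assume r: "0 < r"
      \<comment> \<open>Side length \<open>r / 2\<close> keeps the sum of the coordinate distances
        below \<open>r\<close>, so the product of the two pieces fits into the ball.\<close>
      let ?S = "\<lambda>p. F \<inter> {p<..<p + r / 2}"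
      let ?E = "F \<times> F \<inter> ball (p, q) r"
      have "measure lebesgue (?S p \<times> ?S q) = measure lebesgue (?S p) * measure lebesgue (?S q)"
        using F(1) by (intro measure_lebesgue_Times) auto
      also have "\<dots> > 0" using pos that r by simp
      finally have "of_nat DIM(real \<times> real) \<le> upper_box_dim (?S p \<times> ?S q)"
        by (intro upper_box_dim_positive_measure bounded_Times)
          (auto intro: bounded_subset[of "{a<..<b}" for a b :: real])
      also have "\<dots> \<le> upper_box_dim ?E"
      proof (rule upper_box_dim_nonexpansive_image[where f = id])
        show "?S p \<times> ?S q \<subseteq> id ` ?E"
        proof
          fix z assume "z \<in> ?S p \<times> ?S q"
          then obtain x y where z: "z = (x, y)" "x \<in> ?S p" "y \<in> ?S q" by auto
          have "dist (p, q) z \<le> dist p x + dist q y"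
            unfolding z dist_Pair_Pair by (rule sqrt_sum_squares_le_sum) auto
          then show "z \<in> id ` ?E"
            using z by (auto simp: dist_real_def simp del: dist_Pair_Pair)
        qed
      qed (auto simp: lipschitz_on_def intro: bounded_subset[OF bounded_ball])
      finally show "2 \<le> upper_box_dim ?E" by simp
    qed
  qed
  have cross: "cross_dim (p, q) (F \<times> F) = 2" if D: "p \<in> ?D" "q \<in> ?D" for p q
  proof (rule antisym)
    show "cross_dim (p, q) (F \<times> F) \<le> 2"
      using cross_dim_le[of "(p, q)" "F \<times> F"] by simp
    let ?vs = "[(1, 0), (0, 1)] :: (real \<times> real) list"
    have shift: "0 < measure lebesgue ({t. x + t \<in> F} \<inter> {0<..<\<eta>})" if "x \<in> ?D" "0 < \<eta>" for x \<eta>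
    proof -
      have "F \<inter> {x<..<x + \<eta>} = (+) x ` ({t. x + t \<in> F} \<inter> {0<..<\<eta>})"
        by (auto simp: image_iff intro!: bexI[of _ "y - x" for y])
      then show ?thesis
        using pos[OF that] by (simp add: measure_translation)
    qed
    have pq: "p \<in> F" "q \<in> F" using D density_points_subset by auto
    \<comment> \<open>Along an axis direction one coordinate stays at \<open>p\<close> or
      \<open>q\<close>, a point of \<open>F\<close>; membership in the product reduces to the other
      coordinate, where \<open>shift\<close> applies.\<close>
    have line: "0 < measure lebesgue ({t. (p, q) + t *\<^sub>R v \<in> F \<times> F} \<inter> {0<..<\<eta>})"
      if "v \<in> set ?vs" "0 < \<eta>" for v \<eta>
      using that shift D pq by auto
    have "of_nat (length ?vs) \<le> cross_dim (p, q) (F \<times> F)"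
    proof (rule cross_dim_ge)
      have norm: "norm v = 1" if "v \<in> set ?vs" for v
        using that by (auto simp: norm_Pair)
      show "set ?vs \<subseteq> eff_dirs (p, q) (F \<times> F)"
        using line_in_eff_dirs[OF norm line] by blast
      show "1 \<le> dir_contrib (p, q) (F \<times> F) v" if "v \<in> set ?vs" for v
        using line_dir_contrib[OF norm[OF that] line[OF that]] .
      have "set ?vs \<subseteq> Basis" by (auto simp: Basis_prod_def)
      then show "independent (set ?vs)" using independent_Basis independent_mono by blast
    qed simp
    then show "2 \<le> cross_dim (p, q) (F \<times> F)" by simp
  qed
  have "F - ?D \<in> null_sets lebesgue"
    using negligible_nondensity_points[OF F(2)] by (simp add: negligible_iff_null_sets)
  \<comment> \<open>A point of \<open>F \<times> F\<close> outside \<open>?D \<times> ?D\<close> has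
    a coordinate in \<open>F - ?D\<close>, so these two strips contain the exceptional set.\<close>
  then have "(F - ?D) \<times> UNIV \<union> UNIV \<times> (F - ?D) \<in> null_sets lebesgue"
    by (intro null_sets.Un null_sets_lebesgue_Times)
  then have "F \<times> F - ?D \<times> ?D \<in> null_sets lebesgue"
    by (rule null_sets_completion_subset[rotated]) auto
  with pbox cross density_points_subset[of F] show ?thesis by auto
qed

end
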